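(* Let $A\in\mathbb{R}^{n\times n}$, $B\in\mathbb{R}^{n\times m}$, $H\ge 1$, $\epsilon>0$, and let $\mu:\mathbb{R}_{\ge0}\to\mathbb{R}$ be monotonically increasing. Let $x^i_H\in\mathbb{R}^n$, and let $x^j_0\in\mathbb{R}^n$, $u^j_0,\dots,u^j_{H-1}\in\mathbb{R}^m$ generate $x^j_H$ via $x^j_{k+1}=Ax^j_k+Bu^j_k$. Consider the worst-case distance cost $$\tilde L=\max_{\hat u_0,\dots,\hat u_{H-1}\in\mathbb{R}^m}-\mu(\Vert x^i_H-\hat x_H\Vert^2)\quad\text{s.t. }\hat x_0=x^j_0,\ \hat x_{k+1}=A\hat x_k+B\hat u_k\ (0\le k\le H-1),\ \sum_{k=0}^{H-1}\Vert u^j_k-\hat u_k\Vert^2\le\epsilon^2.$$ Put $z=x^i_H-x^j_H$, $M=[A^{H-1}B,\dots,AB,B]$, let $MM^\top=Q\,\mathrm{diag}(\sigma_1,\dots,\sigma_n)\,Q^\top$ be an eigendecomposition with $Q$ orthogonal and $\sigma_l\ge0$, and let $w=Q^\top z$. Then $$\tilde L=-\mu(\Vert z+\delta z\Vert^2),\qquad \delta z=-MM^\top\left(MM^\top+\lambda I\right)^{\dagger}z,$$ where $\lambda\ge 0$ is determined as follows. The equation $$\sum_{l=1}^n\frac{w_l^2\,\sigma_l}{(\lambda+\sigma_l)^2}=\epsilon^2$$ has a positive root, which is then unique, if and only if $\sum_{l:\sigma_l>0}w_l^2/\sigma_l>\epsilon^2$. If this inequality holds, $\lambda$ is that positive root;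 otherwise $\lambda=0$, and in this case $z+\delta z=0$ if and only if $z\in\operatorname{range}(M)$.
   Context: $\Vert\cdot\Vert$ is the Euclidean norm and ${}^{\dagger}$ denotes the Moore–Penrose pseudoinverse (equal to the ordinary inverse of $MM^\top+\lambda I$ when $\lambda>0$). *)

theory Defs
  imports "Jordan_Normal_Form.Matrix" "HOL-Analysis.L2_Norm"
begin

definition eucl_norm :: "real vec \<Rightarrow> real" where
  "eucl_norm v = L2_set (\<lambda>i. v $ i) {..<dim_vec v}"

definition real_orthogonal_mat :: "nat \<Rightarrow> real mat \<Rightarrow> bool" where
  \<comment> \<open>not \<open>orthogonal_mat\<close>, which only asks for nonzero, pairwise orthogonal columns\<close>
  "real_orthogonal_mat n Q \<longleftrightarrow>
     Q \<in> carrier_mat n n \<and> Q\<^sup>T * Q = 1\<^sub>m n \<and> Q * Q\<^sup>T = 1\<^sub>m n"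

definition is_pinv :: "real mat \<Rightarrow> real mat \<Rightarrow> bool" where
  \<comment> \<open>the four Penrose conditions\<close>
  "is_pinv S X \<longleftrightarrow>
     X \<in> carrier_mat (dim_col S) (dim_row S) \<and>
     S * X * S = S \<and> X * S * X = X \<and>
     (S * X)\<^sup>T = S * X \<and> (X * S)\<^sup>T = X * S"

definition pinv :: "real mat \<Rightarrow> real mat" where
  "pinv S = (THE X. is_pinv S X)"

definition range_mat :: "real mat \<Rightarrow> real vec set" where
  "range_mat S = (\<lambda>v. S *\<^sub>v v) ` carrier_vec (dim_col S)"

definition lti_trajectory ::
  "real mat \<Rightarrow> real mat \<Rightarrow> nat \<Rightarrow> (nat \<Rightarrow> real vec) \<Rightarrow> (nat \<Rightarrow> real vec) \<Rightarrow> bool" where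
  "lti_trajectory A B H x u \<longleftrightarrow>
     (\<forall>k<H. u k \<in> carrier_vec (dim_col B) \<and> x (Suc k) = A *\<^sub>v x k + B *\<^sub>v u k)"

definition ctrb_matrix :: "nat \<Rightarrow> real mat \<Rightarrow> real mat \<Rightarrow> real mat" where
  \<comment> \<open>\<open>[A^(H-1) B, \<dots>, A B, B]\<close>: column \<open>j\<close> is column \<open>j mod m\<close> of block \<open>j div m\<close>,
     where \<open>m = dim_col B\<close>\<close>
  "ctrb_matrix H A B =
     mat (dim_row B) (H * dim_col B)
       (\<lambda>(i, j). (A ^\<^sub>m (H - 1 - j div dim_col B) * B) $$ (i, j mod dim_col B))"

definition cost_values ::
  "real mat \<Rightarrow> real mat \<Rightarrow> nat \<Rightarrow> real \<Rightarrow> (real \<Rightarrow> real) \<Rightarrow> real vec \<Rightarrow> real vec \<Rightarrow>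
   (nat \<Rightarrow> real vec) \<Rightarrow> real set" where
  "cost_values A B H \<epsilon> \<mu> xiH xj0 uj =
     {- \<mu> ((eucl_norm (xiH - xh H))\<^sup>2) | xh uh.
        xh 0 = xj0 \<and> lti_trajectory A B H xh uh \<and>
        (\<Sum>k<H. (eucl_norm (uj k - uh k))\<^sup>2) \<le> \<epsilon>\<^sup>2}"

definition worst_case_cost ::
  "real mat \<Rightarrow> real mat \<Rightarrow> nat \<Rightarrow> real \<Rightarrow> (real \<Rightarrow> real) \<Rightarrow> real vec \<Rightarrow> real vec \<Rightarrow>
   (nat \<Rightarrow> real vec) \<Rightarrow> real" where
  \<comment> \<open>a maximum, which is meaningful only if attained\<close>
  "worst_case_cost A B H \<epsilon> \<mu> xiH xj0 uj =
     (GREATEST c. c \<in> cost_values A B H \<epsilon> \<mu> xiH xj0 uj)"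

definition delta_z :: "real mat \<Rightarrow> real \<Rightarrow> real vec \<Rightarrow> real vec" where
  "delta_z M lam z =
     - ((M * M\<^sup>T * pinv (M * M\<^sup>T + lam \<cdot>\<^sub>m 1\<^sub>m (dim_row M))) *\<^sub>v z)"

end

theory Submission
  imports Defs
begin

text \<open>
  Stacking the input perturbations into one vector \<open>d\<close> turns the terminal error into \<open>z - M d\<close>,
  so the problem is to minimise \<open>\<parallel>z - M d\<parallel>\<close> over the ball \<open>\<parallel>d\<parallel> \<le> \<epsilon>\<close>. A point \<open>d\<^sub>0\<close> with
  \<open>M\<^sup>T (z - M d\<^sub>0) = \<lambda> d\<^sub>0\<close> and either \<open>\<lambda> = 0\<close> or \<open>\<lambda> > 0\<close>, \<open>\<parallel>d\<^sub>0\<parallel> = \<epsilon>\<close>, is optimal by convexity.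
  The choice \<open>d\<^sub>0 = M\<^sup>T (M M\<^sup>T + \<lambda> I)\<^sup>\<dagger> z\<close> satisfies the first condition for every \<open>\<lambda> \<ge> 0\<close>, and in
  eigencoordinates \<open>\<parallel>d\<^sub>0\<parallel>\<^sup>2\<close> is the left-hand side of the secular equation, which strictly decreases
  in \<open>\<lambda>\<close> from \<open>\<Sum> w\<^sub>l\<^sup>2 / \<sigma>\<^sub>l\<close> to \<open>0\<close>. The convention \<open>x / 0 = 0\<close> makes one formula cover both the
  inverse and the pseudoinverse.
\<close>

section \<open>Inner products, and optimality for least squares over a ball\<close>

lemma eucl_norm_square: "(eucl_norm v)\<^sup>2 = v \<bullet> v"
  unfolding eucl_norm_def L2_set_def scalar_prod_def
  by (simp add: sum_nonneg power2_eq_square atLeast0LessThan)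

lemma scalar_prod_self_nonneg: "0 \<le> (v :: real vec) \<bullet> v"
  by (simp flip: eucl_norm_square)

lemma scalar_prod_self_eq_0:
  assumes "(v :: real vec) \<in> carrier_vec n" "v \<bullet> v = 0"
  shows "v = 0\<^sub>v n"
  using assms conjugate_square_eq_0_vec[of v n] by simp

lemma mult_mat_vec_index:
  assumes "A \<in> carrier_mat n m" "v \<in> carrier_vec m" "i < n"
  shows "(A *\<^sub>v v) $ i = (\<Sum>j<m. A $$ (i, j) * v $ j)"
  using assms by (simp add: scalar_prod_def atLeast0LessThan)

lemma minus_vec_eq_0D:
  assumes "(v :: real vec) \<in> carrier_vec n" "w \<in> carrier_vec n" "v - w = 0\<^sub>v n"
  shows "v = w"
proof (rule eq_vecI)
  fix i assume "i < dim_vec w"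
  then show "v $ i = w $ i"
    using assms(1,2) arg_cong[OF assms(3), of "\<lambda>u. u $ i"] by simp
qed (use assms in simp)

text \<open>Pairing the hypothesis with \<open>v\<close> gives the squared norm of
  \<open>M\<^sup>T *\<^sub>v v\<close>. This cancels the leading \<open>M\<close> from identities
  that eigencoordinates yield only for \<open>M * M\<^sup>T\<close>.\<close>

lemma transpose_mult_vec_eq_0:
  fixes M :: "real mat"
  assumes "M \<in> carrier_mat n N" "v \<in> carrier_vec n" "(M * M\<^sup>T) *\<^sub>v v = 0\<^sub>v n"
  shows "M\<^sup>T *\<^sub>v v = 0\<^sub>v N"
proof -
  have "(M\<^sup>T *\<^sub>v v) \<bullet> (M\<^sup>T *\<^sub>v v) = v \<bullet> (M *\<^sub>v (M\<^sup>T *\<^sub>v v))"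
    using assms by (intro transpose_vec_mult_scalar[of M n N]) auto
  also have "\<dots> = v \<bullet> ((M * M\<^sup>T) *\<^sub>v v)"
    using assms by (subst assoc_mult_mat_vec[of M n N "M\<^sup>T" n]) auto
  also have "\<dots> = 0"
    using assms by simp
  finally show ?thesis
    using assms by (intro scalar_prod_self_eq_0) auto
qed

text \<open>Sufficiency of the KKT conditions in a convex problem: \<open>lam\<close> is the
  multiplier and \<open>lam = 0 \<or> d0 \<bullet> d0 = c\<close> is complementary slackness. When
  the residual at \<open>d\<close> is expanded around the one at \<open>d0\<close>, only the cross
  term could lower it, and stationarity makes that term a nonnegative multiple of
  \<open>d0 \<bullet> d0 - d0 \<bullet> d\<close>.\<close>

lemma ball_constrained_least_squares:
  fixes M :: "real mat"
  assumes M: "M \<in> carrier_mat n N" and z: "z \<in> carrier_vec n"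
    and d0: "d0 \<in> carrier_vec N" and d: "d \<in> carrier_vec N"
    and stationary: "M\<^sup>T *\<^sub>v (z - M *\<^sub>v d0) = lam \<cdot>\<^sub>v d0"
    and lam: "lam \<ge> 0" "lam = 0 \<or> d0 \<bullet> d0 = c"
    and dc: "d \<bullet> d \<le> c"
  shows "(z - M *\<^sub>v d0) \<bullet> (z - M *\<^sub>v d0) \<le> (z - M *\<^sub>v d) \<bullet> (z - M *\<^sub>v d)"
proof -
  define r where "r = z - M *\<^sub>v d0"
  define g where "g = M *\<^sub>v (d0 - d)"
  have r: "r \<in> carrier_vec n" and g: "g \<in> carrier_vec n"
    using assms by (auto simp: r_def g_def)
  have "z - M *\<^sub>v d = r + g"
    unfolding r_def g_def using M z d0 d
    by (subst mult_minus_distrib_mat_vec[of M n N]) (auto intro!: eq_vecI)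
  then have expand: "(z - M *\<^sub>v d) \<bullet> (z - M *\<^sub>v d) = r \<bullet> r + 2 * (r \<bullet> g) + g \<bullet> g"
    using r g comm_scalar_prod[OF g r]
    by (simp add: add_scalar_prod_distrib[of _ n] scalar_prod_add_distrib[of _ n])
  have "r \<bullet> g = (M\<^sup>T *\<^sub>v r) \<bullet> (d0 - d)"
    unfolding g_def using M r d0 d by (intro transpose_vec_mult_scalar[symmetric]) auto
  also have "\<dots> = lam * (d0 \<bullet> d0 - d0 \<bullet> d)"
    using stationary d0 d by (simp add: r_def scalar_prod_minus_distrib[of _ N] right_diff_distrib)
  also have "\<dots> \<ge> 0"
  proof (cases "lam = 0")
    case False
    \<comment> \<open>With \<open>d \<bullet> d \<le> c = d0 \<bullet> d0\<close>, this square
      bounds \<open>d0 \<bullet> d\<close> by \<open>d0 \<bullet> d0\<close>, in place of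
      Cauchy-Schwarz.\<close>
    have "0 \<le> (d0 - d) \<bullet> (d0 - d)"
      by (rule scalar_prod_self_nonneg)
    also have "\<dots> = d0 \<bullet> d0 - 2 * (d0 \<bullet> d) + d \<bullet> d"
      using d0 d comm_scalar_prod[OF d d0]
      by (simp add: minus_scalar_prod_distrib[of _ N] scalar_prod_minus_distrib[of _ N])
    finally show ?thesis
      using False lam dc by simp
  qed simp
  finally show ?thesis
    using expand scalar_prod_self_nonneg[of g] by (simp add: r_def)
qed

section \<open>Uniqueness of the pseudoinverse\<close>

text \<open>Penrose's argument: \<open>S * X\<close> and \<open>S * Y\<close> are symmetric and
  absorb one another, hence coincide; likewise \<open>X * S\<close> and \<open>Y * S\<close>. Then
  \<open>X = X * S * X\<close> can be rewritten into \<open>Y * S * Y = Y\<close>.\<close>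

lemma is_pinv_unique:
  assumes X: "is_pinv S X" and Y: "is_pinv S Y"
  shows "X = Y"
proof -
  define r c where "r = dim_row S" and "c = dim_col S"
  have S: "S \<in> carrier_mat r c" by (simp add: r_def c_def)
  have Xc: "X \<in> carrier_mat c r" and Yc: "Y \<in> carrier_mat c r"
    using X Y by (auto simp: is_pinv_def r_def c_def)
  note X = X[unfolded is_pinv_def] and Y = Y[unfolded is_pinv_def]
  have "S * X = (S * X)\<^sup>T" using X by simp
  also have "\<dots> = ((S * Y) * (S * X))\<^sup>T"
    using Y S Xc Yc by (simp flip: assoc_mult_mat[of _ r r _ c _ r])
  also have "\<dots> = (S * X)\<^sup>T * (S * Y)\<^sup>T"
    using S Xc Yc by (intro transpose_mult[of _ r r _ r]) auto
  also have "\<dots> = (S * X) * (S * Y)" using X Y by simp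
  also have "\<dots> = S * Y"
    using X S Xc Yc by (simp flip: assoc_mult_mat[of _ r r _ c _ r])
  finally have SX: "S * X = S * Y" .
  have "X * S = (X * S)\<^sup>T" using X by simp
  also have "\<dots> = ((X * S) * (Y * S))\<^sup>T"
    using Y S Xc Yc assoc_mult_mat[of X c r S c "Y * S" c] assoc_mult_mat[of S r c Y r S c] by simp
  also have "\<dots> = (Y * S)\<^sup>T * (X * S)\<^sup>T"
    using S Xc Yc by (intro transpose_mult[of _ c c _ c]) auto
  also have "\<dots> = (Y * S) * (X * S)" using X Y by simp
  also have "\<dots> = Y * S"
    using X S Xc Yc assoc_mult_mat[of Y c r S c "X * S" c] assoc_mult_mat[of S r c X r S c] by simp
  finally have XS: "X * S = Y * S" .
  have "X = X * S * X" using X by simp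
  also have "\<dots> = Y * (S * X)" using XS assoc_mult_mat[OF Yc S Xc] by simp
  also have "\<dots> = Y * S * Y" using SX assoc_mult_mat[OF Yc S Yc] by simp
  finally show ?thesis using Y by simp
qed

lemma pinv_eqI: "is_pinv S X \<Longrightarrow> pinv S = X"
  unfolding pinv_def using is_pinv_unique by blast

section \<open>Functional calculus in a fixed orthonormal eigenbasis\<close>

text \<open>\<open>M * M\<^sup>T\<close>, its shift by \<open>lam\<close> and the pseudoinverse of
  that shift all have this form with the same \<open>Q\<close>, so matrix identities reduce to
  scalar ones in each eigenvalue.\<close>

definition orth_diag :: "nat \<Rightarrow> real mat \<Rightarrow> (nat \<Rightarrow> real) \<Rightarrow> real mat" where
  "orth_diag n Q f = Q * mat_diag n f * Q\<^sup>T"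

context
  fixes n :: nat and Q :: "real mat"
  assumes Q: "real_orthogonal_mat n Q"
begin

lemma Q_carrier: "Q \<in> carrier_mat n n" "Q\<^sup>T \<in> carrier_mat n n"
  using Q by (auto simp: real_orthogonal_mat_def)

lemma orth_diag_carrier: "orth_diag n Q f \<in> carrier_mat n n"
  using Q_carrier by (auto simp: orth_diag_def)

text \<open>The inner factor \<open>Q\<^sup>T * Q\<close> collapses to the identity.\<close>

lemma orth_diag_mult:
  "orth_diag n Q f * orth_diag n Q g = orth_diag n Q (\<lambda>i. f i * g i)"
proof -
  let ?F = "mat_diag n f" and ?G = "mat_diag n g"
  have D: "?F \<in> carrier_mat n n" "?G \<in> carrier_mat n n" by auto
  have "orth_diag n Q f * orth_diag n Q g = (Q * ?F) * (Q\<^sup>T * (Q * ?G * Q\<^sup>T))"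
    unfolding orth_diag_def using Q_carrier D by (intro assoc_mult_mat[of _ n n _ n _ n]) auto
  also have "Q\<^sup>T * (Q * ?G * Q\<^sup>T) = (Q\<^sup>T * Q) * (?G * Q\<^sup>T)"
    using assoc_mult_mat[OF Q_carrier(1) D(2) Q_carrier(2)]
      assoc_mult_mat[OF Q_carrier(2,1) mult_carrier_mat[OF D(2) Q_carrier(2)]] by simp
  also have "\<dots> = ?G * Q\<^sup>T"
    using Q left_mult_one_mat[OF mult_carrier_mat[OF D(2) Q_carrier(2)]]
    by (simp add: real_orthogonal_mat_def)
  also have "(Q * ?F) * (?G * Q\<^sup>T) = Q * (?F * ?G) * Q\<^sup>T"
    using assoc_mult_mat[OF Q_carrier(1) D(1) mult_carrier_mat[OF D(2) Q_carrier(2)]]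
      assoc_mult_mat[OF D Q_carrier(2)]
      assoc_mult_mat[OF Q_carrier(1) mult_carrier_mat[OF D] Q_carrier(2)]
    by (simp del: mat_diag_diag)
  finally show ?thesis by (simp add: orth_diag_def)
qed

lemma orth_diag_one: "orth_diag n Q (\<lambda>_. 1) = 1\<^sub>m n"
  using Q by (auto simp: orth_diag_def real_orthogonal_mat_def)

lemma orth_diag_transpose: "(orth_diag n Q f)\<^sup>T = orth_diag n Q f"
proof -
  have D: "mat_diag n f \<in> carrier_mat n n" "(mat_diag n f)\<^sup>T = mat_diag n f"
    by (auto simp: mat_diag_def)
  have "(orth_diag n Q f)\<^sup>T = Q\<^sup>T\<^sup>T * (Q * mat_diag n f)\<^sup>T"
    unfolding orth_diag_def using Q_carrier D by (intro transpose_mult[of _ n n _ n]) auto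
  also have "(Q * mat_diag n f)\<^sup>T = mat_diag n f * Q\<^sup>T"
    using transpose_mult[OF Q_carrier(1) D(1)] D(2) by simp
  finally show ?thesis
    using Q_carrier D by (simp add: orth_diag_def assoc_mult_mat[of _ n n _ n _ n])
qed

lemma orth_diag_add_scalar:
  "orth_diag n Q f + c \<cdot>\<^sub>m 1\<^sub>m n = orth_diag n Q (\<lambda>i. f i + c)"
proof -
  let ?F = "mat_diag n f" and ?C = "mat_diag n (\<lambda>_. c)"
  have D: "?F \<in> carrier_mat n n" "?C \<in> carrier_mat n n" by auto
  have C: "?C = c \<cdot>\<^sub>m 1\<^sub>m n" and FC: "mat_diag n (\<lambda>i. f i + c) = ?F + ?C"
    by (auto simp: mat_diag_def)
  have "orth_diag n Q (\<lambda>i. f i + c) = Q * ?F * Q\<^sup>T + Q * ?C * Q\<^sup>T"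
    unfolding orth_diag_def FC using Q_carrier D
    by (simp add: mult_add_distrib_mat[of _ n n _ n] add_mult_distrib_mat[of _ n n _ _ n])
  also have "Q * ?C * Q\<^sup>T = c \<cdot>\<^sub>m (Q * Q\<^sup>T)"
    unfolding C using Q_carrier
    by (simp add: mult_smult_distrib[of _ n n _ n] mult_smult_assoc_mat[of _ n n _ n])
  finally show ?thesis
    using Q by (simp add: orth_diag_def real_orthogonal_mat_def)
qed

lemma orth_diag_mult_vec:
  assumes "z \<in> carrier_vec n"
  shows "orth_diag n Q f *\<^sub>v (orth_diag n Q g *\<^sub>v z) = orth_diag n Q (\<lambda>i. f i * g i) *\<^sub>v z"
  using assoc_mult_mat_vec[OF orth_diag_carrier orth_diag_carrier assms] orth_diag_mult by simp

lemma orth_diag_smult_vec: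
  assumes "z \<in> carrier_vec n"
  shows "orth_diag n Q (\<lambda>i. c * f i) *\<^sub>v z = c \<cdot>\<^sub>v (orth_diag n Q f *\<^sub>v z)"
proof -
  have D: "mat_diag n f \<in> carrier_mat n n" by auto
  have "mat_diag n (\<lambda>i. c * f i) = c \<cdot>\<^sub>m mat_diag n f"
    by (auto simp: mat_diag_def)
  then have "orth_diag n Q (\<lambda>i. c * f i) = c \<cdot>\<^sub>m orth_diag n Q f"
    unfolding orth_diag_def using Q_carrier D
    by (simp add: mult_smult_distrib[of _ n n _ n] mult_smult_assoc_mat[of _ n n _ n])
  then show ?thesis
    using assms orth_diag_carrier[of f] by (auto intro!: eq_vecI)
qed

lemma orth_diag_minus_vec:
  assumes z: "z \<in> carrier_vec n"
  shows "z - orth_diag n Q f *\<^sub>v z = orth_diag n Q (\<lambda>i. 1 - f i) *\<^sub>v z"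
proof -
  let ?F = "mat_diag n f"
  have w: "Q\<^sup>T *\<^sub>v z \<in> carrier_vec n" using Q_carrier z by auto
  have ap: "orth_diag n Q g *\<^sub>v z = Q *\<^sub>v (mat_diag n g *\<^sub>v (Q\<^sup>T *\<^sub>v z))" for g
    unfolding orth_diag_def using Q_carrier z w
    by (simp add: assoc_mult_mat_vec[of _ n n _ n] mat_diag_dim)
  \<comment> \<open>The identity is itself an \<open>orth_diag\<close>, so the subtraction can be
    done inside the diagonal factor.\<close>
  have zz: "z = orth_diag n Q (\<lambda>_. 1) *\<^sub>v z" using z orth_diag_one by simp
  have dist: "mat_diag n (\<lambda>_. 1) *\<^sub>v v - ?F *\<^sub>v v = mat_diag n (\<lambda>i. 1 - f i) *\<^sub>v v"
    if "v \<in> carrier_vec n" for v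
  proof -
    have "mat_diag n (\<lambda>i. 1 - f i) = mat_diag n (\<lambda>_. 1) - ?F"
      by (auto simp: mat_diag_def)
    then show ?thesis
      using that minus_mult_distrib_mat_vec[of "mat_diag n (\<lambda>_. 1)" n n ?F v] by simp
  qed
  have "z - orth_diag n Q f *\<^sub>v z
      = Q *\<^sub>v (mat_diag n (\<lambda>_. 1) *\<^sub>v (Q\<^sup>T *\<^sub>v z)) - Q *\<^sub>v (?F *\<^sub>v (Q\<^sup>T *\<^sub>v z))"
    using zz ap by metis
  also have "\<dots> = Q *\<^sub>v (mat_diag n (\<lambda>_. 1) *\<^sub>v (Q\<^sup>T *\<^sub>v z) - ?F *\<^sub>v (Q\<^sup>T *\<^sub>v z))"
    using Q_carrier w mat_diag_dim mult_mat_vec_carrier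
    by (intro mult_minus_distrib_mat_vec[symmetric, of _ n n]) blast+
  finally show ?thesis using dist[OF w] ap by simp
qed

text \<open>Moving the left \<open>Q\<close> across the inner product leaves a diagonal form in
  \<open>Q\<^sup>T *\<^sub>v z\<close>; this is where the weights of the secular equation come
  from.\<close>

lemma quadratic_form_orth_diag:
  assumes z: "z \<in> carrier_vec n"
  shows "z \<bullet> (orth_diag n Q f *\<^sub>v z) = (\<Sum>l<n. f l * ((Q\<^sup>T *\<^sub>v z) $ l)\<^sup>2)"
proof -
  let ?F = "mat_diag n f" and ?w = "Q\<^sup>T *\<^sub>v z"
  have w: "?w \<in> carrier_vec n" using Q_carrier z by auto
  have Fw: "?F *\<^sub>v ?w \<in> carrier_vec n" using w mat_diag_dim mult_mat_vec_carrier by blast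
  have "(?F *\<^sub>v ?w) $ l = f l * ?w $ l" if "l < n" for l
  proof -
    have "(?F *\<^sub>v ?w) $ l = (\<Sum>i = 0..<n. (if l = i then f i else 0) * ?w $ i)"
      using that w Q_carrier by (simp add: mat_diag_def scalar_prod_def)
    also have "\<dots> = (\<Sum>i = 0..<n. if l = i then f i * ?w $ i else 0)"
      by (intro sum.cong) auto
    finally show ?thesis using that by simp
  qed
  then have "?w \<bullet> (?F *\<^sub>v ?w) = (\<Sum>l<n. f l * (?w $ l)\<^sup>2)"
    using carrier_vecD[OF Fw]
    by (auto simp: scalar_prod_def[of ?w "?F *\<^sub>v ?w"] atLeast0LessThan power2_eq_square
        simp del: index_mult_mat_vec dim_mult_mat_vec intro!: sum.cong)
  moreover have "?w \<bullet> (?F *\<^sub>v ?w) = z \<bullet> (Q *\<^sub>v (?F *\<^sub>v ?w))"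
    using Q_carrier z Fw by (intro transpose_vec_mult_scalar) auto
  moreover have "orth_diag n Q f *\<^sub>v z = Q *\<^sub>v (?F *\<^sub>v ?w)"
    unfolding orth_diag_def using Q_carrier z w
    by (simp add: assoc_mult_mat_vec[of _ n n _ n] mat_diag_dim)
  ultimately show ?thesis by simp
qed

text \<open>The convention \<open>inverse 0 = 0\<close> makes the scalar Penrose identities hold at
  zero eigenvalues too, so singular and invertible matrices are treated together.\<close>

lemma pinv_orth_diag: "pinv (orth_diag n Q f) = orth_diag n Q (\<lambda>i. inverse (f i))"
proof (rule pinv_eqI)
  have "f i * inverse (f i) * f i = f i" "inverse (f i) * f i * inverse (f i) = inverse (f i)" for i
    by (cases "f i = 0"; simp)+
  note inv = this
  show "is_pinv (orth_diag n Q f) (orth_diag n Q (\<lambda>i. inverse (f i)))"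
    using orth_diag_carrier[of f] orth_diag_carrier[of "\<lambda>i. inverse (f i)"]
    by (auto simp: is_pinv_def orth_diag_mult orth_diag_transpose inv)
qed

end

section \<open>Stacked inputs, the controllability matrix and trajectories\<close>

text \<open>The ordering matches the block columns of \<open>ctrb_matrix\<close>: component
  \<open>l\<close> of \<open>e k\<close> sits at index \<open>k * m + l\<close>.\<close>

definition stack_vec :: "nat \<Rightarrow> nat \<Rightarrow> (nat \<Rightarrow> real vec) \<Rightarrow> real vec" where
  "stack_vec H m e = vec (H * m) (\<lambda>j. e (j div m) $ (j mod m))"

lemma stack_vec_carrier: "stack_vec H m e \<in> carrier_vec (H * m)"
  by (simp add: stack_vec_def)

lemma stack_vec_surj:
  assumes "d \<in> carrier_vec (H * m)"
  shows "\<exists>e. (\<forall>k. e k \<in> carrier_vec m) \<and> stack_vec H m e = d"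
proof (intro exI conjI)
  show "\<forall>k. vec m (\<lambda>l. d $ (k * m + l)) \<in> carrier_vec m" by simp
  show "stack_vec H m (\<lambda>k. vec m (\<lambda>l. d $ (k * m + l))) = d"
    using assms
    \<comment> \<open>For \<open>m = 0\<close> both vectors are empty; otherwise
      \<open>j mod m < m\<close> keeps every access inside its block.\<close>
    by (cases "m = 0") (auto simp: stack_vec_def intro!: eq_vecI)
qed

lemma sum_blocks: "(\<Sum>j<H * m. f j) = (\<Sum>k<H. \<Sum>l<m. f (k * m + l))" for m :: nat
proof -
  have "sum f {k * m..<k * m + m} = (\<Sum>l<m. f (k * m + l))" for k
    using sum.shift_bounds_nat_ivl[of f 0 "k * m" m]
    by (simp add: atLeast0LessThan add.commute)
  then show ?thesis by (simp flip: sum.nat_group)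
qed

lemma stack_vec_norm:
  assumes "\<And>k. k < H \<Longrightarrow> e k \<in> carrier_vec m"
  shows "stack_vec H m e \<bullet> stack_vec H m e = (\<Sum>k<H. (eucl_norm (e k))\<^sup>2)"
proof -
  have "stack_vec H m e \<bullet> stack_vec H m e
      = (\<Sum>j<H * m. e (j div m) $ (j mod m) * e (j div m) $ (j mod m))"
    by (simp add: scalar_prod_def stack_vec_def atLeast0LessThan)
  also have "\<dots> = (\<Sum>k<H. \<Sum>l<m. e k $ l * e k $ l)"
    unfolding sum_blocks by (intro sum.cong) auto
  also have "\<dots> = (\<Sum>k<H. (eucl_norm (e k))\<^sup>2)"
    unfolding eucl_norm_square
    by (intro sum.cong) (auto simp: scalar_prod_def atLeast0LessThan carrier_vecD[OF assms])
  finally show ?thesis .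
qed

lemma ctrb_matrix_carrier:
  "B \<in> carrier_mat n m \<Longrightarrow> ctrb_matrix H A B \<in> carrier_mat n (H * m)"
  by (simp add: ctrb_matrix_def)

text \<open>Matrix powers recurse by multiplication on the right, whereas one step of the dynamics
  multiplies on the left.\<close>

lemma pow_mat_Suc_left:
  assumes A: "(A :: 'a :: semiring_1 mat) \<in> carrier_mat n n"
  shows "A ^\<^sub>m Suc k = A * A ^\<^sub>m k"
proof (induction k)
  case (Suc k)
  have "A ^\<^sub>m Suc (Suc k) = (A * A ^\<^sub>m k) * A" using Suc by simp
  then show ?case using A by (simp add: assoc_mult_mat[of _ n n _ n _ n])
qed (use A in auto)

lemma ctrb_matrix_stack_index:
  assumes A: "A \<in> carrier_mat n n" and B: "B \<in> carrier_mat n m"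
    and e: "\<And>k. k < H \<Longrightarrow> e k \<in> carrier_vec m" and i: "i < n"
  shows "(ctrb_matrix H A B *\<^sub>v stack_vec H m e) $ i
       = (\<Sum>k<H. ((A ^\<^sub>m (H - 1 - k) * B) *\<^sub>v e k) $ i)"
proof -
  have "(ctrb_matrix H A B *\<^sub>v stack_vec H m e) $ i
      = (\<Sum>j<H * m. (A ^\<^sub>m (H - 1 - j div m) * B) $$ (i, j mod m) * e (j div m) $ (j mod m))"
    using i B by (simp add: ctrb_matrix_def stack_vec_def scalar_prod_def atLeast0LessThan)
  also have "\<dots> = (\<Sum>k<H. \<Sum>l<m. (A ^\<^sub>m (H - 1 - k) * B) $$ (i, l) * e k $ l)"
    unfolding sum_blocks by (intro sum.cong) auto
  also have "\<dots> = (\<Sum>k<H. ((A ^\<^sub>m (H - 1 - k) * B) *\<^sub>v e k) $ i)"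
  proof (intro sum.cong refl)
    fix k assume "k \<in> {..<H}"
    define C where "C = A ^\<^sub>m (H - 1 - k) * B"
    have "C \<in> carrier_mat n m" using A B by (auto simp: C_def)
    then show "(\<Sum>l<m. (A ^\<^sub>m (H - 1 - k) * B) $$ (i, l) * e k $ l)
        = ((A ^\<^sub>m (H - 1 - k) * B) *\<^sub>v e k) $ i"
      unfolding C_def[symmetric] using e[of k] \<open>k \<in> {..<H}\<close> i
      by (simp add: scalar_prod_def atLeast0LessThan)
  qed
  finally show ?thesis .
qed

text \<open>Lengthening the horizon multiplies every earlier block by \<open>A\<close> and appends
  the block \<open>B\<close>, which is exactly one step of the dynamics.\<close>

lemma ctrb_matrix_stack_Suc:
  assumes A: "A \<in> carrier_mat n n" and B: "B \<in> carrier_mat n m"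
    and e: "\<And>k. k < Suc H \<Longrightarrow> e k \<in> carrier_vec m"
  shows "ctrb_matrix (Suc H) A B *\<^sub>v stack_vec (Suc H) m e
       = A *\<^sub>v (ctrb_matrix H A B *\<^sub>v stack_vec H m e) + B *\<^sub>v e H"
proof (rule eq_vecI)
  show "dim_vec (ctrb_matrix (Suc H) A B *\<^sub>v stack_vec (Suc H) m e)
      = dim_vec (A *\<^sub>v (ctrb_matrix H A B *\<^sub>v stack_vec H m e) + B *\<^sub>v e H)"
    using B by (simp add: ctrb_matrix_def)
  fix i assume "i < dim_vec (A *\<^sub>v (ctrb_matrix H A B *\<^sub>v stack_vec H m e) + B *\<^sub>v e H)"
  then have i: "i < n" using B by simp
  define v where "v k = (A ^\<^sub>m (H - 1 - k) * B) *\<^sub>v e k" for k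
  have v: "v k \<in> carrier_vec n" if "k < H" for k
    unfolding v_def using A B e[of k] that
    by (intro mult_mat_vec_carrier[of _ n m] mult_carrier_mat[of _ n n] pow_carrier_mat) auto
  \<comment> \<open>For horizon \<open>Suc H\<close> the exponent of block \<open>k\<close> is
    \<open>H - k\<close>; as \<open>k < H\<close>, the natural subtraction is not truncated and one
    factor \<open>A\<close> splits off.\<close>
  have step: "(A ^\<^sub>m (H - k) * B) *\<^sub>v e k = A *\<^sub>v v k" if k: "k < H" for k
  proof -
    have P: "A ^\<^sub>m (H - 1 - k) \<in> carrier_mat n n" using A by (rule pow_carrier_mat)
    have "H - k = Suc (H - 1 - k)" using k by simp
    then have "A ^\<^sub>m (H - k) = A * A ^\<^sub>m (H - 1 - k)" using pow_mat_Suc_left[OF A] by metis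
    then have "A ^\<^sub>m (H - k) * B = A * (A ^\<^sub>m (H - 1 - k) * B)"
      using assoc_mult_mat[OF A P B] by simp
    then show ?thesis
      unfolding v_def using assoc_mult_mat_vec[OF A mult_carrier_mat[OF P B] e[of k]] k by simp
  qed
  have ctrb: "(ctrb_matrix H A B *\<^sub>v stack_vec H m e) $ j = (\<Sum>k<H. v k $ j)" if "j < n" for j
    unfolding v_def using A B e that by (intro ctrb_matrix_stack_index) auto
  have s: "ctrb_matrix H A B *\<^sub>v stack_vec H m e \<in> carrier_vec n"
    using ctrb_matrix_carrier[OF B] stack_vec_carrier by (rule mult_mat_vec_carrier)
  \<comment> \<open>The summand \<open>k = H\<close> has exponent \<open>0\<close> and is split off
    as the input term.\<close>
  have "(ctrb_matrix (Suc H) A B *\<^sub>v stack_vec (Suc H) m e) $ i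
      = (\<Sum>k<H. ((A ^\<^sub>m (H - k) * B) *\<^sub>v e k) $ i) + (B *\<^sub>v e H) $ i"
    using ctrb_matrix_stack_index[OF A B e i] A B by simp
  also have "(\<Sum>k<H. ((A ^\<^sub>m (H - k) * B) *\<^sub>v e k) $ i) = (\<Sum>k<H. \<Sum>j<n. A $$ (i, j) * v k $ j)"
    using A i v by (intro sum.cong) (auto simp: step scalar_prod_def atLeast0LessThan intro!: sum.cong)
  also have "\<dots> = (\<Sum>j<n. A $$ (i, j) * (\<Sum>k<H. v k $ j))"
    by (subst sum.swap) (simp add: sum_distrib_left)
  also have "\<dots> = (\<Sum>j<n. A $$ (i, j) * (ctrb_matrix H A B *\<^sub>v stack_vec H m e) $ j)"
    by (simp add: ctrb)
  also have "\<dots> = (A *\<^sub>v (ctrb_matrix H A B *\<^sub>v stack_vec H m e)) $ i"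
    by (rule mult_mat_vec_index[OF A s i, symmetric])
  finally show "(ctrb_matrix (Suc H) A B *\<^sub>v stack_vec (Suc H) m e) $ i
      = (A *\<^sub>v (ctrb_matrix H A B *\<^sub>v stack_vec H m e) + B *\<^sub>v e H) $ i"
    using i A B by simp
qed

lemma lti_trajectory_carrier:
  assumes "A \<in> carrier_mat n n" "B \<in> carrier_mat n m" "lti_trajectory A B H x u"
    and "x 0 \<in> carrier_vec n" "k \<le> H"
  shows "x k \<in> carrier_vec n"
proof (cases k)
  \<comment> \<open>A case split suffices: the row dimensions of the matrices fix the dimension of
    the new state, whatever \<open>x j\<close> is.\<close>
  case (Suc j)
  then have "x k = A *\<^sub>v x j + B *\<^sub>v u j"
    using assms by (auto simp: lti_trajectory_def)
  then show ?thesis using assms(1,2) by (auto intro: carrier_vecI)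
qed (use assms in simp)

text \<open>By linearity the common initial state cancels, and the difference is driven from zero by
  the input differences.\<close>

lemma lti_trajectory_difference:
  assumes A: "A \<in> carrier_mat n n" and B: "B \<in> carrier_mat n m"
    and x: "lti_trajectory A B H x u" and y: "lti_trajectory A B H y v"
    and init: "y 0 = x 0" "x 0 \<in> carrier_vec n"
  shows "y H = x H + ctrb_matrix H A B *\<^sub>v stack_vec H m (\<lambda>k. v k - u k)"
proof -
  let ?e = "\<lambda>k. v k - u k"
  have uv: "u k \<in> carrier_vec m" "v k \<in> carrier_vec m"
    "x (Suc k) = A *\<^sub>v x k + B *\<^sub>v u k" "y (Suc k) = A *\<^sub>v y k + B *\<^sub>v v k" if "k < H" for k
    using x y B that by (auto simp: lti_trajectory_def)
  have "k \<le> H \<Longrightarrow> y k = x k + ctrb_matrix k A B *\<^sub>v stack_vec k m ?e" for k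
  proof (induction k)
    case 0
    show ?case
      using init B by (auto simp: ctrb_matrix_def stack_vec_def scalar_prod_def intro!: eq_vecI)
  next
    case (Suc k)
    let ?s = "ctrb_matrix k A B *\<^sub>v stack_vec k m ?e"
    have k: "k < H" using Suc by simp
    have xk: "x k \<in> carrier_vec n"
      using k by (intro lti_trajectory_carrier[OF A B x init(2)]) auto
    have s: "?s \<in> carrier_vec n"
      using ctrb_matrix_carrier[OF B] stack_vec_carrier by (rule mult_mat_vec_carrier)
    have "B *\<^sub>v v k = B *\<^sub>v u k + B *\<^sub>v (v k - u k)"
      using B uv(1,2)[OF k]
      by (subst mult_minus_distrib_mat_vec[of _ n m]) (auto intro!: eq_vecI)
    then have "y (Suc k) = (A *\<^sub>v x k + A *\<^sub>v ?s) + (B *\<^sub>v u k + B *\<^sub>v (v k - u k))"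
      using Suc k uv(4)[OF k] mult_add_distrib_mat_vec[OF A xk s] by simp
    also have "\<dots> = x (Suc k) + (A *\<^sub>v ?s + B *\<^sub>v (v k - u k))"
      unfolding uv(3)[OF k] using A B xk s uv(1,2)[OF k] by (auto intro!: eq_vecI)
    also have "A *\<^sub>v ?s + B *\<^sub>v (v k - u k) = ctrb_matrix (Suc k) A B *\<^sub>v stack_vec (Suc k) m ?e"
      using k uv(1,2) by (subst ctrb_matrix_stack_Suc[OF A B]) auto
    finally show ?case .
  qed
  then show ?thesis by simp
qed

text \<open>Input differences stack to arbitrary vectors and the constraint becomes a ball, so the
  control problem turns into a finite-dimensional one without dynamics.\<close>

lemma cost_values_eq:
  assumes A: "A \<in> carrier_mat n n" and B: "B \<in> carrier_mat n m"
    and xi: "xi \<in> carrier_vec n" and x0: "x 0 \<in> carrier_vec n"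
    and x: "lti_trajectory A B H x u"
  shows "cost_values A B H \<epsilon> \<mu> xi (x 0) u
    = {- \<mu> ((xi - x H - ctrb_matrix H A B *\<^sub>v d) \<bullet> (xi - x H - ctrb_matrix H A B *\<^sub>v d)) | d.
        d \<in> carrier_vec (H * m) \<and> d \<bullet> d \<le> \<epsilon>\<^sup>2}" (is "_ = {?c d | d. ?P d}")
proof -
  let ?M = "ctrb_matrix H A B"
  have M: "?M \<in> carrier_mat n (H * m)" using B by (rule ctrb_matrix_carrier)
  have xH: "x H \<in> carrier_vec n" using lti_trajectory_carrier[OF A B x x0] by simp
  have u: "u k \<in> carrier_vec m" if "k < H" for k
    using x B that by (auto simp: lti_trajectory_def)
  \<comment> \<open>Both inclusions use this translation of a trajectory into its stacked input
    difference.\<close>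
  have cost: "- \<mu> ((eucl_norm (xi - y H))\<^sup>2) = ?c (stack_vec H m (\<lambda>k. v k - u k))"
    and size: "(\<Sum>k<H. (eucl_norm (u k - v k))\<^sup>2)
      = stack_vec H m (\<lambda>k. v k - u k) \<bullet> stack_vec H m (\<lambda>k. v k - u k)"
    if y: "lti_trajectory A B H y v" and y0: "y 0 = x 0" for y v
  proof -
    let ?d = "stack_vec H m (\<lambda>k. v k - u k)"
    have v: "v k \<in> carrier_vec m" if "k < H" for k
      using y B that by (auto simp: lti_trajectory_def)
    have "xi - y H = xi - x H - ?M *\<^sub>v ?d"
      unfolding lti_trajectory_difference[OF A B x y y0 x0]
      using xi xH M stack_vec_carrier by (auto intro!: eq_vecI)
    then show "- \<mu> ((eucl_norm (xi - y H))\<^sup>2) = ?c ?d"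
      by (simp add: eucl_norm_square)
    have "eucl_norm (u k - v k) = eucl_norm (v k - u k)" if "k < H" for k
      unfolding eucl_norm_def L2_set_def using u[OF that] v[OF that]
      by (auto simp: power2_commute intro!: arg_cong[where f = sqrt] sum.cong)
    then show "(\<Sum>k<H. (eucl_norm (u k - v k))\<^sup>2) = ?d \<bullet> ?d"
      using u v by (subst stack_vec_norm) auto
  qed
  show ?thesis
  proof (intro equalityI subsetI)
    fix c assume "c \<in> cost_values A B H \<epsilon> \<mu> xi (x 0) u"
    then obtain y v where "c = - \<mu> ((eucl_norm (xi - y H))\<^sup>2)" "y 0 = x 0"
      "lti_trajectory A B H y v" "(\<Sum>k<H. (eucl_norm (u k - v k))\<^sup>2) \<le> \<epsilon>\<^sup>2"
      unfolding cost_values_def by blast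
    then show "c \<in> {?c d | d. ?P d}"
      using cost size stack_vec_carrier by fastforce
  next
    fix c assume "c \<in> {?c d | d. ?P d}"
    then obtain d where c: "c = ?c d" and d: "d \<in> carrier_vec (H * m)" "d \<bullet> d \<le> \<epsilon>\<^sup>2" by blast
    obtain e where e: "\<And>k. e k \<in> carrier_vec m" "stack_vec H m e = d"
      using stack_vec_surj[OF d(1)] by blast
    \<comment> \<open>A feasible trajectory realising \<open>d\<close>: add its blocks to the
      nominal inputs and run the dynamics from \<open>x 0\<close>.\<close>
    define v where "v k = u k + e k" for k
    define y where "y = rec_nat (x 0) (\<lambda>k s. A *\<^sub>v s + B *\<^sub>v v k)"
    have y: "lti_trajectory A B H y v" and y0: "y 0 = x 0"
      using u e(1) B by (auto simp: lti_trajectory_def y_def v_def)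
    have "v k - u k = e k" if "k < H" for k
      using u[OF that] e(1)[of k] by (auto simp: v_def intro!: eq_vecI)
    then have "stack_vec H m (\<lambda>k. v k - u k) = stack_vec H m e"
      by (auto simp: stack_vec_def less_mult_imp_div_less intro!: eq_vecI)
    then have dd: "stack_vec H m (\<lambda>k. v k - u k) = d" using e(2) by simp
    have "c = - \<mu> ((eucl_norm (xi - y H))\<^sup>2)"
      using cost[OF y y0] c dd by simp
    moreover have "(\<Sum>k<H. (eucl_norm (u k - v k))\<^sup>2) \<le> \<epsilon>\<^sup>2"
      using size[OF y y0] d dd by simp
    ultimately show "c \<in> cost_values A B H \<epsilon> \<mu> xi (x 0) u"
      unfolding cost_values_def using y y0 by blast
  qed
qed

section \<open>The secular equation\<close>

definition secular :: "nat \<Rightarrow> (nat \<Rightarrow> real) \<Rightarrow> (nat \<Rightarrow> real) \<Rightarrow> real \<Rightarrow> real" where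
  "secular n a s t = (\<Sum>l<n. a l * s l / (t + s l)\<^sup>2)"

context
  fixes n :: nat and a s :: "nat \<Rightarrow> real"
  assumes a_nonneg: "\<And>l. l < n \<Longrightarrow> a l \<ge> 0" and s_nonneg: "\<And>l. l < n \<Longrightarrow> s l \<ge> 0"
begin

text \<open>Every term is nonincreasing, and positivity at \<open>y\<close> provides a nonzero term,
  which decreases strictly; with all numerators zero the sum would be constant.\<close>

lemma secular_strict_antimono:
  assumes "0 \<le> x" "x < y" "secular n a s y > 0"
  shows "secular n a s y < secular n a s x"
  unfolding secular_def
proof (rule sum_strict_mono_ex1)
  have term_less: "a l * s l / (y + s l)\<^sup>2 < a l * s l / (x + s l)\<^sup>2"
    if l: "l < n" and nz: "a l * s l \<noteq> 0" for l
  proof -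
    have "a l * s l > 0" "s l > 0"
      using nz a_nonneg[OF l] s_nonneg[OF l] by (simp_all add: less_le)
    moreover have "(x + s l)\<^sup>2 < (y + s l)\<^sup>2" "0 < (x + s l)\<^sup>2" "0 < (y + s l)\<^sup>2"
      using \<open>s l > 0\<close> assms by (auto intro!: power_strict_mono)
    ultimately show ?thesis by (intro divide_strict_left_mono[OF _ _ mult_pos_pos])
  qed
  then show "\<forall>l\<in>{..<n}. a l * s l / (y + s l)\<^sup>2 \<le> a l * s l / (x + s l)\<^sup>2"
    by (metis div_0 lessThan_iff less_imp_le order_refl)
  have "secular n a s y \<noteq> 0" using assms(3) by simp
  then obtain l where "l < n" "a l * s l / (y + s l)\<^sup>2 \<noteq> 0"
    unfolding secular_def by (rule sum.not_neutral_contains_not_neutral) simp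
  then have "l < n" "a l * s l \<noteq> 0" by (auto simp del: mult_eq_0_iff)
  then show "\<exists>l\<in>{..<n}. a l * s l / (y + s l)\<^sup>2 < a l * s l / (x + s l)\<^sup>2"
    using term_less by blast
qed simp

text \<open>With \<open>x / 0 = 0\<close> the cancellation of \<open>s l\<close> is valid even for
  \<open>s l = 0\<close>, and such terms vanish.\<close>

lemma secular_0: "secular n a s 0 = (\<Sum>l | l < n \<and> s l > 0. a l / s l)"
proof -
  have "secular n a s 0 = (\<Sum>l<n. a l / s l)"
    unfolding secular_def by (intro sum.cong) (auto simp: power2_eq_square)
  also have "\<dots> = (\<Sum>l | l < n \<and> s l > 0. a l / s l)"
    using s_nonneg by (intro sum.mono_neutral_right) (auto simp: less_le)
  finally show ?thesis .
qed

text \<open>The endpoint \<open>0\<close> is included because a term with \<open>s l = 0\<close> is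
  constantly zero, while any other has a positive denominator there.\<close>

lemma continuous_on_secular: "continuous_on {0..} (secular n a s)"
proof -
  have "continuous_on {0..} (\<lambda>t. a l * s l / (t + s l)\<^sup>2)" if "l < n" for l
  proof (cases "s l = 0")
    case False
    then have "s l > 0" using s_nonneg[OF that] by simp
    then show ?thesis by (intro continuous_intros) auto
  qed simp
  then have "continuous_on {0..} (\<lambda>t. \<Sum>l<n. a l * s l / (t + s l)\<^sup>2)"
    by (intro continuous_on_sum) auto
  then show ?thesis by (simp add: secular_def[abs_def])
qed

lemma secular_eventually_small:
  assumes "c > 0"
  shows "\<exists>t\<ge>0. secular n a s t \<le> c"
proof -
  define C where "C = (\<Sum>l<n. a l * s l)"
  have C: "C \<ge> 0" unfolding C_def using a_nonneg s_nonneg by (intro sum_nonneg) auto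
  \<comment> \<open>Chosen so that \<open>t \<ge> 1\<close>, whence
    \<open>(t + s l)\<^sup>2 \<ge> t\<close>, and so that \<open>c * t = c + C\<close> exceeds
    \<open>C\<close>.\<close>
  define t where "t = 1 + C / c"
  have t: "t \<ge> 1" using C assms by (simp add: t_def)
  have "secular n a s t \<le> (\<Sum>l<n. a l * s l / t)"
    unfolding secular_def
  proof (intro sum_mono divide_left_mono)
    fix l assume "l \<in> {..<n}"
    then have l: "s l \<ge> 0" "a l \<ge> 0" using a_nonneg s_nonneg by auto
    have "t * 1 \<le> (t + s l) * (t + s l)"
      using t l by (intro mult_mono) auto
    then show "t \<le> (t + s l)\<^sup>2" by (simp add: power2_eq_square)
    then show "0 < (t + s l)\<^sup>2 * t" using t by (intro mult_pos_pos) linarith+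
    show "0 \<le> a l * s l" using l by simp
  qed
  also have "\<dots> = C / t" by (simp add: C_def sum_divide_distrib)
  also have "\<dots> \<le> c"
  proof -
    have "C \<le> c * t" using assms by (simp add: t_def field_simps)
    then show ?thesis using t by (simp add: pos_divide_le_eq)
  qed
  finally show ?thesis using t by (intro exI[of _ t]) auto
qed

text \<open>The sum on the right is the value at \<open>0\<close>. A positive root lies strictly
  below it by monotonicity; conversely the intermediate value theorem applies between
  \<open>0\<close> and a point where the function is at most \<open>c\<close>.\<close>

lemma secular_root_iff:
  assumes c: "c > 0"
  shows "(\<exists>t>0. secular n a s t = c) \<longleftrightarrow> (\<Sum>l | l < n \<and> s l > 0. a l / s l) > c"
proof
  assume "\<exists>t>0. secular n a s t = c"
  then show "(\<Sum>l | l < n \<and> s l > 0. a l / s l) > c"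
    using secular_strict_antimono[of 0] c secular_0 by auto
next
  assume "(\<Sum>l | l < n \<and> s l > 0. a l / s l) > c"
  then have gt: "secular n a s 0 > c" by (simp add: secular_0)
  obtain T where T: "T \<ge> 0" "secular n a s T \<le> c" using secular_eventually_small[OF c] by blast
  have "continuous_on {0..T} (secular n a s)"
    using continuous_on_secular by (rule continuous_on_subset) auto
  then obtain t where "0 \<le> t" "secular n a s t = c"
    using IVT2'[of "secular n a s" T c 0] T gt by auto
  moreover from this gt have "t \<noteq> 0" by auto
  ultimately show "\<exists>t>0. secular n a s t = c" by (intro exI[of _ t]) auto
qed

lemma secular_root_unique:
  assumes "c > 0" "x > 0" "secular n a s x = c" "y > 0" "secular n a s y = c"
  shows "x = y"
  using assms secular_strict_antimono[of x y] secular_strict_antimono[of y x]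
  by (cases x y rule: linorder_cases) auto

end

section \<open>The optimal perturbation and the worst-case cost\<close>

text \<open>
  For \<open>lam = 0\<close> the quotient \<open>\<sigma> / (\<sigma> + lam)\<close> is \<open>0\<close> on the kernel of \<open>M M\<^sup>T\<close>, so \<open>z + \<delta>z\<close> is
  the kernel component of \<open>z\<close>.
\<close>

lemma delta_z_stationary:
  fixes M Q :: "real mat"
  assumes M: "M \<in> carrier_mat n N" and Q: "real_orthogonal_mat n Q"
    and s: "\<And>l. l < n \<Longrightarrow> \<sigma> l \<ge> 0" and MM: "M * M\<^sup>T = Q * mat_diag n \<sigma> * Q\<^sup>T"
    and z: "z \<in> carrier_vec n" and lam: "lam \<ge> 0"
  obtains d where "d \<in> carrier_vec N"
    "z + delta_z M lam z = z - M *\<^sub>v d"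
    "M\<^sup>T *\<^sub>v (z - M *\<^sub>v d) = lam \<cdot>\<^sub>v d"
    "d \<bullet> d = (\<Sum>l<n. ((Q\<^sup>T *\<^sub>v z) $ l)\<^sup>2 * \<sigma> l / (lam + \<sigma> l)\<^sup>2)"
proof
  let ?U = "orth_diag n Q"
  \<comment> \<open>\<open>p\<close> is the regularised pseudoinverse applied to
    \<open>z\<close>.\<close>
  define p where "p = ?U (\<lambda>l. inverse (\<sigma> l + lam)) *\<^sub>v z"
  define d where "d = M\<^sup>T *\<^sub>v p"
  have U: "?U f \<in> carrier_mat n n" for f using orth_diag_carrier[OF Q] .
  have MU: "M * M\<^sup>T = ?U \<sigma>" using MM by (simp add: orth_diag_def)
  have MT: "M\<^sup>T \<in> carrier_mat N n" using M by simp
  have p: "p \<in> carrier_vec n" unfolding p_def using U z by (rule mult_mat_vec_carrier)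
  show d: "d \<in> carrier_vec N" unfolding d_def using MT p by (rule mult_mat_vec_carrier)
  have Md: "M *\<^sub>v d = ?U \<sigma> *\<^sub>v p"
    unfolding d_def using assoc_mult_mat_vec[OF M MT p] MU by simp
  have Md': "M *\<^sub>v d = ?U (\<lambda>l. \<sigma> l * inverse (\<sigma> l + lam)) *\<^sub>v z"
    unfolding Md p_def using orth_diag_mult_vec[OF Q z] .
  have "M * M\<^sup>T * pinv (M * M\<^sup>T + lam \<cdot>\<^sub>m 1\<^sub>m (dim_row M))
      = ?U (\<lambda>l. \<sigma> l * inverse (\<sigma> l + lam))"
    using M by (simp add: MU orth_diag_add_scalar[OF Q] pinv_orth_diag[OF Q] orth_diag_mult[OF Q])
  then have "delta_z M lam z = - (M *\<^sub>v d)"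
    by (simp add: delta_z_def Md')
  then show "z + delta_z M lam z = z - M *\<^sub>v d"
    using M d z by (simp add: minus_add_uminus_vec[of _ n])
  show "M\<^sup>T *\<^sub>v (z - M *\<^sub>v d) = lam \<cdot>\<^sub>v d"
  proof -
    let ?r = "z - M *\<^sub>v d"
    have r: "?r \<in> carrier_vec n" using M d z by auto
    \<comment> \<open>Stationarity premultiplied by \<open>M\<close>, read off per eigenvalue. If
      \<open>\<sigma> l + lam = 0\<close>, nonnegativity forces both to be zero and both sides
      vanish.\<close>
    have res: "\<sigma> l * (1 - \<sigma> l * inverse (\<sigma> l + lam)) = lam * (\<sigma> l * inverse (\<sigma> l + lam))"
      if "l < n" for l
    proof (cases "\<sigma> l + lam = 0")
      case True
      then show ?thesis using s[OF that] lam by simp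
    qed (simp add: field_simps)
    have "(M * M\<^sup>T) *\<^sub>v ?r = ?U (\<lambda>l. \<sigma> l * (1 - \<sigma> l * inverse (\<sigma> l + lam))) *\<^sub>v z"
      unfolding MU Md' orth_diag_minus_vec[OF Q z] by (rule orth_diag_mult_vec[OF Q z])
    also have "\<dots> = ?U (\<lambda>l. lam * (\<sigma> l * inverse (\<sigma> l + lam))) *\<^sub>v z"
    proof -
      \<comment> \<open>The scalar identity is known only for \<open>l < n\<close>, so the diagonal
        matrices are equated rather than the functions.\<close>
      have "mat_diag n (\<lambda>l. \<sigma> l * (1 - \<sigma> l * inverse (\<sigma> l + lam)))
          = mat_diag n (\<lambda>l. lam * (\<sigma> l * inverse (\<sigma> l + lam)))"
        using res by (auto simp: mat_diag_def)
      then show ?thesis unfolding orth_diag_def by simp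
    qed
    also have "\<dots> = lam \<cdot>\<^sub>v ((M * M\<^sup>T) *\<^sub>v p)"
      unfolding MU Md[symmetric] Md' by (rule orth_diag_smult_vec[OF Q z])
    finally have "(M * M\<^sup>T) *\<^sub>v (?r - lam \<cdot>\<^sub>v p) = 0\<^sub>v n"
      using mult_minus_distrib_mat_vec[OF U[of \<sigma>] r, of "lam \<cdot>\<^sub>v p"] U[of \<sigma>] p
      by (simp add: MU mult_mat_vec[of _ n n])
    then have "M\<^sup>T *\<^sub>v (?r - lam \<cdot>\<^sub>v p) = 0\<^sub>v N"
      using M r p by (intro transpose_mult_vec_eq_0) auto
    then have diff: "M\<^sup>T *\<^sub>v ?r - lam \<cdot>\<^sub>v d = 0\<^sub>v N"
      using MT r p mult_minus_distrib_mat_vec[OF MT r, of "lam \<cdot>\<^sub>v p"]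
      by (simp add: d_def mult_mat_vec[of _ N n])
    have "M\<^sup>T *\<^sub>v ?r \<in> carrier_vec N" using MT r by (rule mult_mat_vec_carrier)
    then show ?thesis
      by (rule minus_vec_eq_0D[OF _ _ diff]) (use d in simp)
  qed
  have "d \<bullet> d = p \<bullet> (?U \<sigma> *\<^sub>v p)"
    using transpose_vec_mult_scalar[OF M d p] Md by (simp add: d_def)
  \<comment> \<open>Symmetry moves the reciprocal off the left copy of \<open>p\<close>; the two
    reciprocals produce the squared denominator.\<close>
  also have "\<dots> = z \<bullet> (?U (\<lambda>l. inverse (\<sigma> l + lam)) *\<^sub>v (?U \<sigma> *\<^sub>v p))"
    using transpose_vec_mult_scalar[OF U _ z] U mult_mat_vec_carrier[OF U p]
    unfolding p_def by (metis orth_diag_transpose[OF Q])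
  also have "\<dots> = (\<Sum>l<n. ((Q\<^sup>T *\<^sub>v z) $ l)\<^sup>2 * \<sigma> l / (lam + \<sigma> l)\<^sup>2)"
    unfolding p_def orth_diag_mult_vec[OF Q z] quadratic_form_orth_diag[OF Q z]
    by (intro sum.cong) (auto simp: divide_inverse power2_eq_square add.commute)
  finally show "d \<bullet> d = (\<Sum>l<n. ((Q\<^sup>T *\<^sub>v z) $ l)\<^sup>2 * \<sigma> l / (lam + \<sigma> l)\<^sup>2)" .
qed

text \<open>\<open>GREATEST\<close> and \<open>THE\<close> are informative only when their objects
  exist, so attainment, the upper bound and unique existence of the root accompany the
  formula.\<close>

theorem mainTheorem2:
  fixes A B M Q :: "real mat"
    and n m H :: nat
    and \<epsilon> :: real
    and \<mu> :: "real \<Rightarrow> real"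
    and xiH z w :: "real vec"
    and xj uj :: "nat \<Rightarrow> real vec"
    and \<sigma> :: "nat \<Rightarrow> real"
  assumes "A \<in> carrier_mat n n"
    and "B \<in> carrier_mat n m"
    and "H \<ge> 1"
    and "\<epsilon> > 0"
    and "mono_on {0..} \<mu>"
    and "xiH \<in> carrier_vec n"
    and "xj 0 \<in> carrier_vec n"
    and "lti_trajectory A B H xj uj"
    and "z = xiH - xj H"
    and "M = ctrb_matrix H A B"
    and "real_orthogonal_mat n Q"
    and "\<And>l. l < n \<Longrightarrow> \<sigma> l \<ge> 0"
    and "M * M\<^sup>T = Q * mat_diag n \<sigma> * Q\<^sup>T"
    and "w = Q\<^sup>T *\<^sub>v z"
  shows
    "let costs = cost_values A B H \<epsilon> \<mu> xiH (xj 0) uj;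
         Lt = worst_case_cost A B H \<epsilon> \<mu> xiH (xj 0) uj;
         is_root = (\<lambda>t. (\<Sum>l<n. (w $ l)\<^sup>2 * \<sigma> l / (t + \<sigma> l)\<^sup>2) = \<epsilon>\<^sup>2);
         active = ((\<Sum>l | l < n \<and> \<sigma> l > 0. (w $ l)\<^sup>2 / \<sigma> l) > \<epsilon>\<^sup>2);
         lam = (if active then (THE t. t > 0 \<and> is_root t) else 0);
         \<delta>z = delta_z M lam z
     in ((\<exists>t>0. is_root t) \<longleftrightarrow> active)
      \<and> ((\<exists>t>0. is_root t) \<longrightarrow> (\<exists>!t. t > 0 \<and> is_root t))
      \<and> lam \<ge> 0
      \<and> Lt \<in> costs \<and> (\<forall>c\<in>costs. c \<le> Lt)
      \<and> Lt = - \<mu> ((eucl_norm (z + \<delta>z))\<^sup>2)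
      \<and> (\<not> active \<longrightarrow> (z + \<delta>z = 0\<^sub>v n \<longleftrightarrow> z \<in> range_mat M))"
proof -
  let ?a = "\<lambda>l. (w $ l)\<^sup>2"
  define f where "f t = (\<Sum>l<n. (w $ l)\<^sup>2 * \<sigma> l / (t + \<sigma> l)\<^sup>2)" for t
  define active where "active \<longleftrightarrow> (\<Sum>l | l < n \<and> \<sigma> l > 0. (w $ l)\<^sup>2 / \<sigma> l) > \<epsilon>\<^sup>2"
  define lam where "lam = (if active then (THE t. t > 0 \<and> f t = \<epsilon>\<^sup>2) else 0)"
  define costs where "costs = cost_values A B H \<epsilon> \<mu> xiH (xj 0) uj"
  have f_eq: "f = secular n (\<lambda>l. (w $ l)\<^sup>2) \<sigma>"
    by (simp add: fun_eq_iff f_def secular_def)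
  note sec = secular_root_iff[of n ?a \<sigma>, folded f_eq] secular_root_unique[of n ?a \<sigma>, folded f_eq]
    secular_0[of n ?a \<sigma>, folded f_eq]
  have eps: "\<epsilon>\<^sup>2 > 0" using assms(4) by simp
  have root_iff: "(\<exists>t>0. f t = \<epsilon>\<^sup>2) \<longleftrightarrow> active"
    unfolding active_def using sec(1)[OF _ assms(12) eps] by simp
  have root_unique: "x = y" if "x > 0" "f x = \<epsilon>\<^sup>2" "y > 0" "f y = \<epsilon>\<^sup>2" for x y
    using sec(2)[OF _ assms(12) eps that] by simp
  have root_ex1: "(\<exists>t>0. f t = \<epsilon>\<^sup>2) \<longrightarrow> (\<exists>!t. t > 0 \<and> f t = \<epsilon>\<^sup>2)"
    using root_unique by blast
  have lam_active: "lam > 0 \<and> f lam = \<epsilon>\<^sup>2" if active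
    using theI'[of "\<lambda>t. t > 0 \<and> f t = \<epsilon>\<^sup>2"] root_ex1 root_iff that by (simp add: lam_def)
  \<comment> \<open>The negated inequality bounds \<open>f 0\<close>, which makes the unregularised
    minimiser feasible.\<close>
  have lam_inactive: "lam = 0" "f lam \<le> \<epsilon>\<^sup>2" if "\<not> active"
    using that sec(3)[OF _ assms(12)] by (simp_all add: lam_def active_def)
  \<comment> \<open>Both cases together give feasibility and complementary slackness.\<close>
  have lam: "lam \<ge> 0" and flam: "f lam \<le> \<epsilon>\<^sup>2" "lam = 0 \<or> f lam = \<epsilon>\<^sup>2"
    using lam_active lam_inactive by (cases active; force)+

  have M: "M \<in> carrier_mat n (H * m)" using assms ctrb_matrix_carrier by simp
  have xH: "xj H \<in> carrier_vec n"
    using lti_trajectory_carrier[OF assms(1,2,8,7)] by simp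
  have z: "z \<in> carrier_vec n" using assms xH by simp
  obtain d where d: "d \<in> carrier_vec (H * m)"
    and dz: "z + delta_z M lam z = z - M *\<^sub>v d"
    and stat: "M\<^sup>T *\<^sub>v (z - M *\<^sub>v d) = lam \<cdot>\<^sub>v d" and dd: "d \<bullet> d = f lam"
    using delta_z_stationary[OF M assms(11,12,13) z lam] unfolding f_def assms(14) by blast
  have costs: "costs = {- \<mu> ((z - M *\<^sub>v v) \<bullet> (z - M *\<^sub>v v)) | v. v \<in> carrier_vec (H * m) \<and> v \<bullet> v \<le> \<epsilon>\<^sup>2}"
    unfolding costs_def cost_values_eq[of A n B m xiH xj H uj, OF assms(1,2,6,7,8)] assms(9,10) ..
  define c where "c = - \<mu> ((eucl_norm (z + delta_z M lam z))\<^sup>2)"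
  have c_eq: "c = - \<mu> ((z - M *\<^sub>v d) \<bullet> (z - M *\<^sub>v d))"
    by (simp add: c_def dz eucl_norm_square)
  have c_in: "c \<in> costs" unfolding costs c_eq using d dd flam by auto
  have c_max: "b \<le> c" if b_in: "b \<in> costs" for b
  proof -
    obtain v where v: "v \<in> carrier_vec (H * m)" "v \<bullet> v \<le> \<epsilon>\<^sup>2"
      and b: "b = - \<mu> ((z - M *\<^sub>v v) \<bullet> (z - M *\<^sub>v v))"
      using b_in unfolding costs by blast
    have "(z - M *\<^sub>v d) \<bullet> (z - M *\<^sub>v d) \<le> (z - M *\<^sub>v v) \<bullet> (z - M *\<^sub>v v)"
      using ball_constrained_least_squares[OF M z d v(1) stat lam _ v(2)] dd flam by simp
    \<comment> \<open>\<open>\<mu>\<close> is monotone on nonnegative arguments, which squared norms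
      are; the minus sign turns the least distance into the greatest cost.\<close>
    then show ?thesis
      unfolding b c_eq using mono_onD[OF assms(5)] scalar_prod_self_nonneg by simp
  qed
  have Lt: "worst_case_cost A B H \<epsilon> \<mu> xiH (xj 0) uj = c"
    unfolding worst_case_cost_def using c_in c_max
    by (intro Greatest_equality) (auto simp: costs_def)
  have range: "z + delta_z M lam z = 0\<^sub>v n \<longleftrightarrow> z \<in> range_mat M" if "\<not> active"
  proof
    assume "z + delta_z M lam z = 0\<^sub>v n"
    then have "z - M *\<^sub>v d = 0\<^sub>v n" using dz by simp
    then have "z = M *\<^sub>v d"
      by (rule minus_vec_eq_0D[OF z mult_mat_vec_carrier[OF M d]])
    then show "z \<in> range_mat M" using M d by (auto simp: range_mat_def)
  next
    assume "z \<in> range_mat M"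
    then obtain v where v: "v \<in> carrier_vec (H * m)" "z = M *\<^sub>v v"
      using M by (auto simp: range_mat_def)
    let ?r = "z - M *\<^sub>v d"
    have r: "?r \<in> carrier_vec n" using z M d by auto
    \<comment> \<open>The residual lies in the range of \<open>M\<close>, and for
      \<open>lam = 0\<close> stationarity makes it orthogonal to that range, hence zero.\<close>
    have "?r = M *\<^sub>v (v - d)"
      using M v d by (simp add: mult_minus_distrib_mat_vec[of _ n "H * m"])
    then have "?r \<bullet> ?r = (M\<^sup>T *\<^sub>v ?r) \<bullet> (v - d)"
      using transpose_vec_mult_scalar[OF M _ r, of "v - d"] v d by simp
    also have "\<dots> = 0"
      unfolding stat lam_inactive(1)[OF that] using v d by simp
    finally show "z + delta_z M lam z = 0\<^sub>v n"
      unfolding dz using r by (intro scalar_prod_self_eq_0)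
  qed
  show ?thesis
    unfolding Let_def f_def[symmetric] active_def[symmetric] lam_def[symmetric]
      costs_def[symmetric] Lt
    by (intro conjI ballI impI) (fact root_iff root_ex1[rule_format] lam c_in c_max c_def range)+
qed

end
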